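(* Let $(\beta,\alpha)\in\Delta$. The bifurcation set $$E^{+}_{\beta,\alpha}=\{t\in[0,1)\colon T_{\beta,\alpha}^{n}(t)\notin[0,t)\text{ for all }n\in\mathbb{N}_0\}$$ has full Hausdorff dimension, that is, its Hausdorff dimension equals $1$.
   Context: $\mathbb{N}_0=\{0,1,2,\dots\}$. $\Delta=\{(b,a)\in\mathbb{R}^2\colon b\in(1,2),\ a\in[0,2-b]\}$. For $(\beta,\alpha)\in\Delta$, $T_{\beta,\alpha}\colon[0,1]\to[0,1]$, $T_{\beta,\alpha}(x)=\beta x+\alpha\bmod 1$. *)

theory Defs
  imports "HOL-Analysis.Analysis"
begin

(* The gauge |U|^s, with the conventions |{}|^s = 0 for every s and |U|^0 = 1 for nonempty U
   (in the library, 0 powr 0 = 0), so that the measure for s = 0 is the counting measure. *)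
definition hausdorff_gauge :: "real \<Rightarrow> 'a::metric_space set \<Rightarrow> ennreal" where
  "hausdorff_gauge s U =
     (if U = {} then 0 else if s = 0 then 1 else ennreal (diameter U powr s))"

(* The library's diameter is only meaningful on bounded sets, so boundedness of the covering sets
   is required explicitly.  Finite covers are included because U i may be empty. *)
definition hausdorff_pre_measure :: "real \<Rightarrow> real \<Rightarrow> 'a::metric_space set \<Rightarrow> ennreal" where
  "hausdorff_pre_measure s \<delta> A =
     Inf {(\<Sum>i. hausdorff_gauge s (U i)) | U :: nat \<Rightarrow> 'a set.
            A \<subseteq> (\<Union>i. U i) \<and> (\<forall>i. bounded (U i) \<and> diameter (U i) \<le> \<delta>)}"

definition hausdorff_measure :: "real \<Rightarrow> 'a::metric_space set \<Rightarrow> ennreal" where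
  "hausdorff_measure s A = (SUP \<delta>\<in>{0<..}. hausdorff_pre_measure s \<delta> A)"

(* Extended-valued: the infimum of the empty set is \<infinity>. *)
definition hausdorff_dim :: "'a::metric_space set \<Rightarrow> ennreal" where
  "hausdorff_dim A = Inf {ennreal s | s. s \<ge> 0 \<and> hausdorff_measure s A = 0}"

definition Delta :: "(real \<times> real) set" where
  "Delta = {(b, a). b \<in> {1<..<2} \<and> a \<in> {0..2 - b}}"

definition T :: "real \<Rightarrow> real \<Rightarrow> real \<Rightarrow> real" where
  "T \<beta> \<alpha> x = frac (\<beta> * x + \<alpha>)"

lemma T_unit_interval: "T \<beta> \<alpha> ` {0..1} \<subseteq> {0..1}"
  by (auto simp: T_def less_imp_le[OF frac_lt_1])

definition E_plus :: "real \<Rightarrow> real \<Rightarrow> real set" where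
  "E_plus \<beta> \<alpha> = {t \<in> {0..<1}. \<forall>n::nat. (T \<beta> \<alpha> ^^ n) t \<notin> {0..<t}}"

end

theory Submission
  imports Defs
begin

text \<open>
  Fix \<open>s < 1\<close> and take \<open>N\<close> so large that \<open>q = \<beta> ^ N\<close> exceeds \<open>200\<close> and \<open>5 * q powr s\<close>.
  Let \<open>\<delta>\<close> be the minimal distance between points of the finite set consisting of \<open>0\<close> and the
  discontinuities of \<open>T ^^ N\<close>, and \<open>\<epsilon> = \<delta> / 100\<close>.  Every interval of length \<open>\<delta> / 2\<close> contains
  at most one discontinuity of \<open>T ^^ N\<close>, hence a piece of length at least \<open>\<delta> / 4\<close> on which
  \<open>T ^^ N\<close> is affine with slope \<open>q\<close>.  Removing an initial segment of length \<open>\<epsilon>\<close> from the piece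
  keeps its first \<open>N\<close> images above \<open>\<epsilon>\<close>; the rest contains at least \<open>q / 5\<close> well separated
  intervals that \<open>T ^^ N\<close> maps onto intervals of length \<open>\<delta> / 2\<close>, and the construction repeats.
  Started in \<open>[0, \<epsilon>)\<close>, where the first \<open>N\<close> iterates satisfy
  \<open>(T ^^ j) x = (T ^^ j) 0 + \<beta> ^ j * x \<ge> x\<close>, this yields a Cantor subset of \<open>E_plus\<close>, which has
  positive \<open>s\<close>-dimensional measure since each interval has at least \<open>q powr s\<close> children of
  relative length \<open>1 / q\<close>.
\<close>

section \<open>Hausdorff measure on the real line\<close>

text \<open>Splitting the unit interval into \<open>m\<close> intervals of length
  \<open>1 / m\<close> gives total weight \<open>m powr (1 - s)\<close>, which tends to 0.\<close>

lemma hausdorff_measure_eq_0_of_gt_1: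
  fixes A :: "real set"
  assumes "A \<subseteq> {0..1}" "s > 1"
  shows "hausdorff_measure s A = 0"
proof -
  have "hausdorff_pre_measure s d A \<le> 0" if d: "d > 0" for d
  proof (rule ennreal_le_epsilon)
    fix e :: real assume e: "e > 0"
    have lim: "(\<lambda>n. real (Suc n) powr (1 - s)) \<longlonglongrightarrow> 0"
      using assms(2)
      by (intro tendsto_neg_powr filterlim_compose[OF filterlim_real_sequentially] filterlim_Suc) auto
    have "\<forall>\<^sub>F n in sequentially. real (Suc n) powr (1 - s) < e"
      using lim e by (rule order_tendstoD)
    moreover have "\<forall>\<^sub>F n in sequentially. inverse (real (Suc n)) < d"
      using LIMSEQ_inverse_real_of_nat d by (rule order_tendstoD)
    ultimately have "\<forall>\<^sub>F n in sequentially. real (Suc n) powr (1 - s) < e \<and> inverse (real (Suc n)) < d"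
      by (rule eventually_conj)
    then obtain n where n: "real (Suc n) powr (1 - s) < e" "inverse (real (Suc n)) < d"
      by (auto simp: eventually_sequentially)
    define m where "m = Suc n"
    define U where "U i = (if i < m then {real i / m .. real (Suc i) / m} else {})" for i :: nat
    have m: "m > 0" by (simp add: m_def)
    have len: "real (Suc i) / m - real i / m = 1 / m" for i
      by (simp add: diff_divide_distrib[symmetric])
    have diam: "diameter (U i) = (if i < m then 1 / m else 0)" for i
    proof (cases "i < m")
      case True
      have "real i / m \<le> real (Suc i) / m" by (intro divide_right_mono) auto
      with True len[of i] show ?thesis by (simp add: U_def del: of_nat_Suc)
    qed (simp add: U_def)
    have cover: "A \<subseteq> (\<Union>i. U i)"
    proof
      fix x assume "x \<in> A"
      then have x: "0 \<le> x" "x \<le> 1" using assms(1) by auto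
      show "x \<in> (\<Union>i. U i)"
      \<comment> \<open>At the right endpoint the index \<open>\<lfloor>x * m\<rfloor>\<close> would
        be \<open>m\<close>, one too large; the last interval contains it.\<close>
      proof (cases "x = 1")
        case True
        then have "x \<in> U n" by (simp add: U_def m_def)
        then show ?thesis by blast
      next
        case False
        define i where "i = nat \<lfloor>x * m\<rfloor>"
        have i: "real i \<le> x * m" "x * m < real i + 1"
          using x by (auto simp: i_def)
        have "x * m < 1 * real m"
          using x False m by (intro mult_strict_right_mono) auto
        then have "i < m" using i by linarith
        then have "x \<in> U i" using i m by (simp add: U_def field_simps)
        then show ?thesis by blast
      qed
    qed
    have "hausdorff_pre_measure s d A \<le> (\<Sum>i. hausdorff_gauge s (U i))"
      unfolding hausdorff_pre_measure_def
    proof (rule Inf_lower, rule CollectI, intro exI conjI allI)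
      show "bounded (U i)" for i by (simp add: U_def)
      show "diameter (U i) \<le> d" for i
        using n(2) d by (simp add: diam m_def field_simps)
    qed (use cover in auto)
    also have "\<dots> = (\<Sum>i<m. hausdorff_gauge s (U i))"
      by (rule suminf_finite) (auto simp: U_def hausdorff_gauge_def)
    also have "\<dots> \<le> (\<Sum>i<m. ennreal ((1 / m) powr s))"
      using assms(2) by (intro sum_mono) (auto simp: hausdorff_gauge_def diam)
    also have "\<dots> = ennreal (m * (1 / m) powr s)"
      by (simp add: ennreal_of_nat_eq_real_of_nat ennreal_mult')
    also have "real m * (1 / m) powr s = m powr (1 - s)"
      using m by (simp add: powr_divide powr_diff)
    also have "ennreal \<dots> \<le> ennreal e"
      using n(1) by (intro ennreal_leI) (simp add: m_def)
    finally show "hausdorff_pre_measure s d A \<le> 0 + ennreal e" by simp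
  qed
  then have "hausdorff_measure s A \<le> 0"
    unfolding hausdorff_measure_def by (intro SUP_least) auto
  then show ?thesis by simp
qed

text \<open>
  Given a cover of small total weight, descend through nodes such that the sets meeting the node of
  level \<open>m\<close> have total weight at most \<open>(L * r) powr s * (r powr s) ^ m\<close>.  Each such set is then
  shorter than the children, so it meets at most one of them, and some child inherits at most the
  average weight.  The limit point avoids the whole cover.
\<close>
lemma hausdorff_measure_ne_0_of_tree:
  fixes G :: "nat \<Rightarrow> real \<Rightarrow> bool"
  assumes s: "0 < s" and L: "0 < L" and r: "0 < r" "r < 1"
    and root: "G 0 a0"
    and children: "\<And>m a. G m a \<Longrightarrow> \<exists>C. finite C \<and> (1 / r) powr s \<le> real (card C) \<and>
          (\<forall>c\<in>C. G (Suc m) c \<and> {c..c + L * r ^ Suc m} \<subseteq> {a..a + L * r ^ m}) \<and>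
          pairwise (\<lambda>c d. 2 * (L * r ^ Suc m) \<le> \<bar>c - d\<bar>) C"
    and limit: "\<And>x. (\<And>m. \<exists>a. G m a \<and> x \<in> {a..a + L * r ^ m}) \<Longrightarrow> x \<in> E"
  shows "hausdorff_measure s E \<noteq> 0"
proof
  assume null: "hausdorff_measure s E = 0"
  \<comment> \<open>With this value \<open>A * (r powr s) ^ m\<close> is the \<open>s\<close>-th
    power of the child length \<open>L * r ^ Suc m\<close>, so a single set within the weight budget
    is shorter than a child.\<close>
  define A where "A = (L * r) powr s"
  have A: "A > 0" using L r by (simp add: A_def)
  have "hausdorff_pre_measure s 1 E \<le> hausdorff_measure s E"
    unfolding hausdorff_measure_def by (rule SUP_upper) simp
  then have "hausdorff_pre_measure s 1 E < ennreal (A / 2)"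
    using null A by simp
  then obtain U :: "nat \<Rightarrow> real set" where cover: "E \<subseteq> (\<Union>i. U i)" and bdd: "\<And>i. bounded (U i)"
    and small: "(\<Sum>i. hausdorff_gauge s (U i)) < ennreal (A / 2)"
    unfolding hausdorff_pre_measure_def Inf_less_iff by blast
  \<comment> \<open>The geometric term makes the weight of sets of diameter 0 positive.\<close>
  define w where "w i = diameter (U i) powr s + A / 2 * (1 / 2) ^ Suc i" for i
  have w_gt: "diameter (U i) powr s < w i" for i using A by (simp add: w_def)
  have w_pos: "w i > 0" for i
    using w_gt[of i] by (smt (verit) powr_ge_zero)
  have w_sum: "sum w F \<le> A" if "finite F" for F
  proof -
    have "ennreal (\<Sum>i\<in>F. diameter (U i) powr s) = (\<Sum>i\<in>F. ennreal (diameter (U i) powr s))"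
      by simp
    also have "\<dots> \<le> (\<Sum>i\<in>F. hausdorff_gauge s (U i))"
      using s by (intro sum_mono) (auto simp: hausdorff_gauge_def)
    also have "\<dots> \<le> (\<Sum>i. hausdorff_gauge s (U i))"
      using that by (intro sum_le_suminf) auto
    also have "\<dots> < ennreal (A / 2)" by (rule small)
    finally have 1: "(\<Sum>i\<in>F. diameter (U i) powr s) \<le> A / 2"
      by (simp add: ennreal_less_iff sum_nonneg)
    have "(\<Sum>i\<in>F. (1 / 2 :: real) ^ Suc i) \<le> (\<Sum>i. (1 / 2) ^ Suc i)"
      using that power_half_series by (intro sum_le_suminf) (auto simp: sums_iff)
    also have "\<dots> = 1" using power_half_series by (simp add: sums_iff)
    finally have "A / 2 * (\<Sum>i\<in>F. (1 / 2 :: real) ^ Suc i) \<le> A / 2 * 1"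
      using A by (intro mult_left_mono) auto
    with 1 show ?thesis
      by (simp add: w_def sum.distrib sum_distrib_left del: power_Suc)
  qed
  define I where "I m a = {a..a + L * r ^ m}" for m a
  define S where "S m a = {i. U i \<inter> I m a \<noteq> {}}" for m a
  \<comment> \<open>Bounding all finite partial sums covers infinite \<open>S m a\<close> without a
    summability argument.\<close>
  define Q where "Q m a \<longleftrightarrow> G m a \<and> (\<forall>F. finite F \<longrightarrow> F \<subseteq> S m a \<longrightarrow> sum w F \<le> A * (r powr s) ^ m)" for m a
  have "\<exists>a. \<forall>m. Q m (a m) \<and> I (Suc m) (a (Suc m)) \<subseteq> I m (a m)"
  proof (rule dependent_nat_choice)
    show "\<exists>a. Q 0 a" using root w_sum by (auto simp: Q_def)
  next
    fix a m assume Q: "Q m a"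
    then have G: "G m a" and Sm: "\<And>F. finite F \<Longrightarrow> F \<subseteq> S m a \<Longrightarrow> sum w F \<le> A * (r powr s) ^ m"
      by (auto simp: Q_def)
    from children[OF G] obtain C where C: "finite C" "(1 / r) powr s \<le> real (card C)"
      "\<And>c. c \<in> C \<Longrightarrow> G (Suc m) c" "\<And>c. c \<in> C \<Longrightarrow> I (Suc m) c \<subseteq> I m a"
      and sep: "pairwise (\<lambda>c d. 2 * (L * r ^ Suc m) \<le> \<bar>c - d\<bar>) C"
      unfolding I_def by blast
    have sub: "S (Suc m) c \<subseteq> S m a" if "c \<in> C" for c
      using C(4)[OF that] by (auto simp: S_def)
    have diam: "diameter (U i) < L * r ^ Suc m" if "i \<in> S m a" for i
    proof -
      have "diameter (U i) powr s < w i" by (rule w_gt)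
      also have "w i \<le> A * (r powr s) ^ m" using Sm[of "{i}"] that by simp
      also have "\<dots> = (L * r ^ Suc m) powr s"
        using L r by (simp add: A_def powr_mult powr_realpow[symmetric] powr_powr powr_powr_swap mult_ac)
      finally show ?thesis
        using L r s powr_mono2[of s "L * r ^ Suc m" "diameter (U i)"] by (meson less_imp_le mult_pos_pos not_le zero_less_power)
    qed
    \<comment> \<open>Points of distinct children are at least one child length apart, more than the
      diameter of any \<open>U i\<close> meeting the parent.\<close>
    have disj: "S (Suc m) c \<inter> S (Suc m) d = {}" if "c \<in> C" "d \<in> C" "c \<noteq> d" for c d
    proof (rule ccontr)
      assume "\<not> ?thesis"
      then obtain i x y where i: "i \<in> S (Suc m) c" "x \<in> U i" "x \<in> I (Suc m) c" "y \<in> U i" "y \<in> I (Suc m) d"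
        by (auto simp: S_def)
      have "dist x y \<le> diameter (U i)" using i bdd by (intro diameter_bounded_bound) auto
      also have "\<dots> < L * r ^ Suc m" using diam sub i that by blast
      finally have "dist x y < L * r ^ Suc m" .
      moreover have "2 * (L * r ^ Suc m) \<le> \<bar>c - d\<bar>"
        using sep that by (auto simp: pairwise_def)
      ultimately show False using i by (auto simp: I_def dist_real_def abs_if split: if_splits)
    qed
    \<comment> \<open>Averaging: if every child exceeded its budget, the disjoint families
      \<open>F c\<close> would together outweigh the budget of the parent.\<close>
    have "\<exists>c\<in>C. Q (Suc m) c"
    proof (rule ccontr)
      assume "\<not> ?thesis"
      then have "\<forall>c\<in>C. \<exists>F. finite F \<and> F \<subseteq> S (Suc m) c \<and> A * (r powr s) ^ Suc m < sum w F"
        using C(3) unfolding Q_def by (meson not_le)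
      then obtain F where F: "\<And>c. c \<in> C \<Longrightarrow> finite (F c)" "\<And>c. c \<in> C \<Longrightarrow> F c \<subseteq> S (Suc m) c"
        "\<And>c. c \<in> C \<Longrightarrow> A * (r powr s) ^ Suc m < sum w (F c)" by metis
      have "card C > 0"
        using C(2) r by (smt (verit) divide_pos_pos of_nat_0_less_iff powr_gt_zero)
      then have "C \<noteq> {}" by auto
      have "A * (r powr s) ^ m = (1 / r) powr s * (A * (r powr s) ^ Suc m)"
        using r by (simp add: powr_divide)
      also have "\<dots> \<le> card C * (A * (r powr s) ^ Suc m)"
        using C(2) A by (intro mult_right_mono) auto
      also have "\<dots> = (\<Sum>c\<in>C. A * (r powr s) ^ Suc m)" by simp
      also have "\<dots> < (\<Sum>c\<in>C. sum w (F c))"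
        using F(3) C(1) \<open>C \<noteq> {}\<close> by (intro sum_strict_mono) auto
      also have "\<dots> = sum w (\<Union>c\<in>C. F c)"
      proof (rule sum.UNION_disjoint[symmetric])
        show "\<forall>c\<in>C. \<forall>d\<in>C. c \<noteq> d \<longrightarrow> F c \<inter> F d = {}" using F(2) disj by blast
      qed (use C F in auto)
      also have "\<dots> \<le> A * (r powr s) ^ m"
        using F sub C(1) by (intro Sm) blast+
      finally show False by simp
    qed
    then show "\<exists>c. Q (Suc m) c \<and> I (Suc m) c \<subseteq> I m a" using C(4) by blast
  qed
  then obtain a where a: "\<And>m. Q m (a m)" "\<And>m. I (Suc m) (a (Suc m)) \<subseteq> I m (a m)" by blast
  have "(\<Inter>m. I m (a m)) \<noteq> {}"
  proof (rule compact_nest)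
    show "compact (I m (a m))" "I m (a m) \<noteq> {}" for m
      using L r by (auto simp: I_def)
    show "I n (a n) \<subseteq> I m (a m)" if "m \<le> n" for m n
      using lift_Suc_antimono_le[of "\<lambda>m. I m (a m)"] a(2) that by blast
  qed
  then obtain x where x: "\<And>m. x \<in> I m (a m)" by blast
  have "x \<in> E" using a(1) x by (intro limit) (auto simp: Q_def I_def)
  then obtain i where i: "x \<in> U i" using cover by blast
  \<comment> \<open>\<open>U i\<close> meets every chosen node, so the fixed positive weight
    \<open>w i\<close> lies below a null sequence.\<close>
  have le: "w i \<le> A * (r powr s) ^ m" for m
  proof -
    have "i \<in> S m (a m)" using i x by (auto simp: S_def)
    then have "finite {i}" "{i} \<subseteq> S m (a m)" by simp_all
    then have "sum w {i} \<le> A * (r powr s) ^ m" using a(1)[of m] unfolding Q_def by metis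
    then show ?thesis by simp
  qed
  have "r powr s < 1 powr s" using r s by (intro powr_less_mono2) auto
  then have "r powr s < 1" by simp
  then have "(\<lambda>m. A * (r powr s) ^ m) \<longlonglongrightarrow> A * 0"
    by (intro tendsto_mult_left LIMSEQ_power_zero) simp
  then have "w i \<le> A * 0" using le by (intro LIMSEQ_le_const) auto
  with w_pos[of i] show False by simp
qed

section \<open>Iterates of the intermediate beta-transformation\<close>

locale beta_map =
  fixes \<beta> \<alpha> :: real
  assumes Delta: "(\<beta>, \<alpha>) \<in> Delta"
begin

abbreviation f :: "real \<Rightarrow> real" where "f \<equiv> T \<beta> \<alpha>"

text \<open>The only discontinuity of \<open>f\<close> in \<open>[0, 1)\<close>: here
  \<open>\<beta> * x + \<alpha>\<close> reaches 1, and \<open>\<alpha> + \<beta> \<le> 2\<close>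
  keeps it below 2.\<close>

definition cut :: real where "cut = (1 - \<alpha>) / \<beta>"

lemma params: "1 < \<beta>" "\<beta> < 2" "0 \<le> \<alpha>" "\<alpha> + \<beta> \<le> 2"
  using Delta by (auto simp: Delta_def)

lemma funpow_f_mem: "x \<in> {0..<1} \<Longrightarrow> (f ^^ n) x \<in> {0..<1}"
  by (induction n) (auto simp: T_def frac_lt_1)

lemma f_eq:
  assumes "0 \<le> x" "x < 1"
  shows "f x = (if x < cut then \<beta> * x + \<alpha> else \<beta> * x + \<alpha> - 1)"
proof -
  have "\<beta> * x + \<alpha> < 2"
    using assms params mult_strict_left_mono[of x 1 \<beta>] by linarith
  moreover have "x < cut \<longleftrightarrow> \<beta> * x + \<alpha> < 1"
    using params by (simp add: cut_def field_simps)
  moreover have "0 \<le> \<beta> * x + \<alpha>" using assms params by simp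
  ultimately show ?thesis
    by (auto simp: T_def frac_unique_iff)
qed

text \<open>The value at \<open>cut\<close> belongs to the right branch, so a half-open interval may
  begin or end at \<open>cut\<close>.\<close>

lemma f_affine:
  assumes "0 \<le> u" "v \<le> 1" "x \<in> {u..<v}" "cut \<notin> {u<..<v}"
  shows "f x = f u + \<beta> * (x - u)"
  using assms by (auto simp: f_eq algebra_simps)

text \<open>Each of the two branches is injective, so a point has at most two preimages under
  \<open>f\<close>.\<close>

lemma finite_funpow_preimage: "finite {x \<in> {0..<1}. (f ^^ n) x = c}"
proof (induction n arbitrary: c)
  case 0
  have "{x \<in> {0..<1}. (f ^^ 0) x = c} \<subseteq> {c}" by auto
  then show ?case by (rule finite_subset) simp
next
  case (Suc n)
  define Y where "Y = {y \<in> {0..<1}. f y = c}"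
  have "Y \<subseteq> {(c - \<alpha>) / \<beta>, (c + 1 - \<alpha>) / \<beta>}"
    using params by (auto simp: Y_def f_eq field_simps split: if_splits)
  then have "finite Y" by (rule finite_subset) simp
  moreover have "{x \<in> {0..<1}. (f ^^ Suc n) x = c} \<subseteq> (\<Union>y\<in>Y. {x \<in> {0..<1}. (f ^^ n) x = y})"
    using funpow_f_mem by (auto simp: Y_def)
  ultimately show ?case using Suc by (meson finite_UN_I finite_subset)
qed

text \<open>All iterates up to \<open>n\<close> are included because membership in
  \<open>E_plus\<close> constrains the intermediate times too.\<close>

definition affine_on :: "nat \<Rightarrow> real \<Rightarrow> real \<Rightarrow> bool" where
  "affine_on n u v \<longleftrightarrow> (\<forall>j\<le>n. \<forall>x\<in>{u..<v}. (f ^^ j) x = (f ^^ j) u + \<beta> ^ j * (x - u))"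

lemma affine_onD:
  "affine_on n u v \<Longrightarrow> j \<le> n \<Longrightarrow> x \<in> {u..<v} \<Longrightarrow> (f ^^ j) x = (f ^^ j) u + \<beta> ^ j * (x - u)"
  unfolding affine_on_def by blast

text \<open>An image reaching beyond 1 would contain the value 1 itself, which no iterate of a point
  of \<open>[0, 1)\<close> takes.\<close>

lemma affine_on_image_le_1:
  assumes "affine_on n u v" "0 \<le> u" "u < v" "v \<le> 1"
  shows "(f ^^ n) u + \<beta> ^ n * (v - u) \<le> 1"
proof (rule ccontr)
  assume neg: "\<not> ?thesis"
  have pos: "\<beta> ^ n > 0" using params by simp
  have u: "(f ^^ n) u < 1" using funpow_f_mem[of u n] assms by auto
  define x where "x = u + (1 - (f ^^ n) u) / \<beta> ^ n"
  have "(1 - (f ^^ n) u) / \<beta> ^ n < v - u"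
    using neg pos by (simp add: divide_less_eq mult.commute)
  moreover have "0 \<le> (1 - (f ^^ n) u) / \<beta> ^ n" using u pos by simp
  ultimately have x: "x \<in> {u..<v}" by (simp add: x_def)
  then have "(f ^^ n) x = (f ^^ n) u + \<beta> ^ n * (x - u)"
    by (rule affine_onD[OF assms(1) order_refl])
  also have "\<dots> = 1" using params by (simp add: x_def)
  finally show False using funpow_f_mem[of x n] x assms by auto
qed

text \<open>Induction on \<open>n\<close>: the \<open>n\<close>-th iterate maps the interval
  affinely onto \<open>[y, w)\<close> with \<open>w \<le> 1\<close>. If \<open>cut\<close> were
  interior to this image, its preimage \<open>z\<close> would be an excluded interior point.\<close>

lemma affine_onI:
  assumes "0 \<le> u" "v \<le> 1" "\<And>j x. j < n \<Longrightarrow> x \<in> {u<..<v} \<Longrightarrow> (f ^^ j) x \<noteq> cut"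
  shows "affine_on n u v"
  using assms(3)
proof (induction n)
  case 0
  then show ?case by (simp add: affine_on_def)
next
  case (Suc n)
  then have aff: "affine_on n u v" by simp
  have pos: "\<beta> ^ n > 0" using params by simp
  have "(f ^^ Suc n) x = (f ^^ Suc n) u + \<beta> ^ Suc n * (x - u)" if x: "x \<in> {u..<v}" for x
  proof -
    define y where "y = (f ^^ n) u"
    define w where "w = y + \<beta> ^ n * (v - u)"
    have "y \<in> {0..<1}" unfolding y_def using assms x by (intro funpow_f_mem) auto
    moreover have "w \<le> 1"
      unfolding w_def y_def using affine_on_image_le_1[OF aff] assms x by auto
    moreover have fx: "(f ^^ n) x = y + \<beta> ^ n * (x - u)"
      unfolding y_def using affine_onD[OF aff order_refl x] .
    then have "(f ^^ n) x \<in> {y..<w}"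
      using x pos by (auto simp: w_def)
    moreover have "cut \<notin> {y<..<w}"
    proof
      assume cut: "cut \<in> {y<..<w}"
      define z where "z = u + (cut - y) / \<beta> ^ n"
      have "(cut - y) / \<beta> ^ n < v - u"
        using cut unfolding pos_divide_less_eq[OF pos] by (simp add: w_def algebra_simps)
      moreover have "0 < (cut - y) / \<beta> ^ n" using cut pos by simp
      ultimately have z: "z \<in> {u<..<v}" by (simp add: z_def)
      then have "(f ^^ n) z = y + \<beta> ^ n * (z - u)"
        unfolding y_def using z by (intro affine_onD[OF aff order_refl]) auto
      also have "\<dots> = cut" using params by (simp add: z_def)
      finally show False using Suc.prems[of n z] z by simp
    qed
    ultimately have "f ((f ^^ n) x) = f y + \<beta> * ((f ^^ n) x - y)"
      by (intro f_affine) auto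
    then show ?thesis by (simp add: fx y_def)
  qed
  then show ?case unfolding affine_on_def le_Suc_eq using affine_onD[OF aff] by blast
qed

lemma obtain_separation:
  obtains \<delta> where "0 < \<delta>" "affine_on n 0 \<delta>" "\<delta> \<le> 1"
    "\<And>u. 0 \<le> u \<Longrightarrow> u + \<delta> / 2 \<le> 1 \<Longrightarrow>
      \<exists>a b. u \<le> a \<and> b \<le> u + \<delta> / 2 \<and> \<delta> / 4 \<le> b - a \<and> affine_on n a b"
proof -
  define D where "D = (\<Union>j<n. {x \<in> {0..<1}. (f ^^ j) x = cut})"
  have "finite D" unfolding D_def using finite_funpow_preimage by blast
  have affine: "affine_on n u v" if "0 \<le> u" "v \<le> 1" "D \<inter> {u<..<v} = {}" for u v
  proof (rule affine_onI[OF that(1,2)])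
    fix j x assume "j < n" "x \<in> {u<..<v}"
    moreover from this have "x \<notin> D" "x \<in> {0..<1}" using that by auto
    ultimately show "(f ^^ j) x \<noteq> cut" by (auto simp: D_def)
  qed
  \<comment> \<open>Adjoining 0 to \<open>D\<close> keeps \<open>(0, \<delta>)\<close> free of
    \<open>D\<close>; the element 1 makes \<open>P\<close> nonempty and gives
    \<open>\<delta> \<le> 1\<close>.\<close>
  define P where "P = insert 1 ((\<lambda>(x, y). \<bar>x - y\<bar>) ` {(x, y) \<in> insert 0 D \<times> insert 0 D. x \<noteq> y})"
  have "finite {(x, y) \<in> insert 0 D \<times> insert 0 D. x \<noteq> y}"
    using \<open>finite D\<close> by (rule_tac finite_subset[of _ "insert 0 D \<times> insert 0 D"]) auto
  then have P: "finite P" "P \<noteq> {}" by (auto simp: P_def)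
  define \<delta> where "\<delta> = Min P"
  have pos: "0 < \<delta>" unfolding \<delta>_def using P by (subst Min_gr_iff) (auto simp: P_def)
  have le1: "\<delta> \<le> 1" unfolding \<delta>_def using P by (intro Min_le) (auto simp: P_def)
  have sep: "\<delta> \<le> \<bar>x - y\<bar>" if "x \<in> insert 0 D" "y \<in> insert 0 D" "x \<noteq> y" for x y
    unfolding \<delta>_def using P that by (intro Min_le) (auto simp: P_def)
  show ?thesis
  proof (rule that[of \<delta>])
    have "D \<inter> {0<..<\<delta>} = {}"
    proof (rule equals0I)
      fix x assume "x \<in> D \<inter> {0<..<\<delta>}"
      with sep[of x 0] show False by auto
    qed
    then show "affine_on n 0 \<delta>" using le1 by (intro affine) auto
  next
    fix u :: real assume u: "0 \<le> u" "u + \<delta> / 2 \<le> 1"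
    show "\<exists>a b. u \<le> a \<and> b \<le> u + \<delta> / 2 \<and> \<delta> / 4 \<le> b - a \<and> affine_on n a b"
    proof (cases "D \<inter> {u<..<u + \<delta> / 2} = {}")
      case True
      then have "affine_on n u (u + \<delta> / 2)" using u by (intro affine) auto
      then show ?thesis using pos by (intro exI[of _ u] exI[of _ "u + \<delta> / 2"]) auto
    next
      case False
      then obtain d where d: "d \<in> D" "u < d" "d < u + \<delta> / 2" by auto
      have uniq: False if "x \<in> D" "u < x" "x < u + \<delta> / 2" "x \<noteq> d" for x
      proof -
        have "\<delta> \<le> \<bar>x - d\<bar>" using d that by (intro sep) auto
        then show False using d that by linarith
      qed
      have "D \<inter> {u<..<d} = {}" "D \<inter> {d<..<u + \<delta> / 2} = {}"
        using uniq d by (auto simp: disjoint_iff) force+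
      then have "affine_on n u d" "affine_on n d (u + \<delta> / 2)"
        using u d by (auto intro: affine)
      moreover have "\<delta> / 4 \<le> d - u \<or> \<delta> / 4 \<le> (u + \<delta> / 2) - d" by linarith
      ultimately show ?thesis using d(2,3) by (meson less_imp_le order_refl)
    qed
  qed (use pos le1 in auto)
qed

section \<open>Dimension of the bifurcation set\<close>

lemma hausdorff_measure_E_plus_ne_0:
  assumes s: "0 < s" "s < 1"
  shows "hausdorff_measure s (E_plus \<beta> \<alpha>) \<noteq> 0"
proof -
  \<comment> \<open>The power of 5 yields \<open>5 \<le> q powr (1 - s)\<close>; the bound 200 gives
    \<open>L < \<epsilon>\<close> and absorbs the rounding in the number of children.\<close>
  obtain N where N: "max 200 (5 powr (1 / (1 - s))) < \<beta> ^ N"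
    using real_arch_pow params(1) by blast
  define q where "q = \<beta> ^ N"
  have q: "200 < q" "5 powr (1 / (1 - s)) < q" using N by (auto simp: q_def)
  have "5 = (5 powr (1 / (1 - s))) powr (1 - s)" using s by (simp add: powr_powr)
  also have "\<dots> \<le> q powr (1 - s)" using q s by (intro powr_mono2) auto
  finally have "5 * q powr s \<le> q powr (1 - s) * q powr s" by (intro mult_right_mono) auto
  also have "\<dots> = q" using q by (simp add: powr_add[symmetric])
  finally have qs: "q powr s \<le> q / 5" by simp
  obtain \<delta> where \<delta>: "0 < \<delta>" "affine_on N 0 \<delta>" "\<delta> \<le> 1"
    and split: "\<And>u. 0 \<le> u \<Longrightarrow> u + \<delta> / 2 \<le> 1 \<Longrightarrow>
      \<exists>a b. u \<le> a \<and> b \<le> u + \<delta> / 2 \<and> \<delta> / 4 \<le> b - a \<and> affine_on N a b"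
    by (rule obtain_separation[of N]) blast
  define \<epsilon> where "\<epsilon> = \<delta> / 100"
  have \<epsilon>: "0 < \<epsilon>" "\<epsilon> < \<delta>" "\<epsilon> < 1" using \<delta> by (auto simp: \<epsilon>_def)
  define L where "L = \<delta> / (2 * q)"
  define r where "r = 1 / q"
  have L: "0 < L" "L < \<epsilon>" using \<delta> q by (auto simp: L_def \<epsilon>_def field_simps)
  have r: "0 < r" "r < 1" using q by (auto simp: r_def)
  \<comment> \<open>Nodes stay below \<open>\<epsilon>\<close>, so at later times it suffices to
    keep the images above \<open>\<epsilon>\<close>. The time \<open>N * Suc m\<close> is when a
    node of level \<open>m\<close> has been stretched to length \<open>\<delta> / 2\<close>.\<close>
  define G where "G m a \<longleftrightarrow> 0 \<le> a \<and> a + L * r ^ m < \<epsilon> \<and>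
    (\<forall>j\<le>N * Suc m. \<forall>x\<in>{a..a + L * r ^ m}.
        (f ^^ j) x = (f ^^ j) a + \<beta> ^ j * (x - a) \<and> x \<le> (f ^^ j) x)" for m a
  have image_length: "\<beta> ^ (N * Suc m) * (L * r ^ m) = \<delta> / 2" for m
    unfolding power_mult q_def[symmetric] L_def r_def using q by (simp add: field_simps)
  have nonneg: "0 \<le> (f ^^ j) x" if "0 \<le> x" "x < 1" for j x
    using funpow_f_mem[of x j] that by auto
  show ?thesis
  proof (rule hausdorff_measure_ne_0_of_tree[of s L r G 0, OF s(1) L(1) r])
    have "(f ^^ j) x = (f ^^ j) 0 + \<beta> ^ j * x \<and> x \<le> (f ^^ j) x"
      if "j \<le> N" "x \<in> {0..L}" for j x
    proof -
      have eq: "(f ^^ j) x = (f ^^ j) 0 + \<beta> ^ j * (x - 0)"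
        using that L \<epsilon> by (intro affine_onD[OF \<delta>(2)]) auto
      have "1 * x \<le> \<beta> ^ j * x"
        using that params by (intro mult_right_mono) auto
      with eq nonneg[of 0 j] show ?thesis by simp
    qed
    then have "\<forall>j\<le>N * Suc 0. \<forall>x\<in>{0..0 + L * r ^ 0}.
        (f ^^ j) x = (f ^^ j) 0 + \<beta> ^ j * (x - 0) \<and> x \<le> (f ^^ j) x"
      unfolding mult_Suc_right mult_0_right add_0_right power_0 mult_1_right add_0_left diff_zero
      by blast
    moreover have "0 + L * r ^ 0 < \<epsilon>" using L by simp
    ultimately show "G 0 0" unfolding G_def by blast
  next
    fix m a assume G: "G m a"
    define n where "n = N * Suc m"
    define y where "y = (f ^^ n) a"
    define l where "l = L * r ^ m"
    have a: "0 \<le> a" "a + l < \<epsilon>" using G unfolding G_def l_def by blast+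
    have l: "0 < l" using L r by (simp add: l_def)
    have aff: "(f ^^ j) x = (f ^^ j) a + \<beta> ^ j * (x - a)" "x \<le> (f ^^ j) x"
      if "j \<le> n" "x \<in> {a..a + l}" for j x
      using G that unfolding G_def n_def l_def by blast+
    have bn: "\<beta> ^ n > 0" using params by simp
    have bnl: "\<beta> ^ n * l = \<delta> / 2" using image_length[of m] by (simp add: n_def l_def)
    have l_eq: "l = \<delta> / 2 / \<beta> ^ n"
      using bnl bn by (metis less_irrefl nonzero_mult_div_cancel_left)
    have "(f ^^ n) (a + l) = y + \<delta> / 2"
      using aff(1)[of n "a + l"] l bnl by (simp add: y_def)
    then have y1: "y + \<delta> / 2 \<le> 1"
      using funpow_f_mem[of "a + l" n] a l \<epsilon> by auto
    have y0: "0 \<le> y" unfolding y_def using a l \<epsilon> by (intro nonneg) auto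
    from split[OF y0 y1] obtain u v where uv: "y \<le> u" "v \<le> y + \<delta> / 2" "\<delta> / 4 \<le> v - u" "affine_on N u v"
      by blast
    \<comment> \<open>A piece of length at least \<open>25 * \<delta> / 100\<close> loses
      \<open>\<epsilon> = \<delta> / 100\<close>; the remaining \<open>24 * \<delta> / 100\<close>
      holds \<open>K\<close> slots of width \<open>\<delta> / q\<close>.\<close>
    define K where "K = nat \<lfloor>q * 24 / 100\<rfloor>"
    \<comment> \<open>Each slot is used on its left half only, which produces the gaps;
      \<open>c i\<close> pulls \<open>p i\<close> back along the affine branch of
      \<open>f ^^ n\<close>.\<close>
    define p where "p i = u + \<epsilon> + real i * (\<delta> / q)" for i
    define c where "c i = a + (p i - y) / \<beta> ^ n" for i
    have K: "real K \<le> q * 24 / 100" "q * 24 / 100 < real K + 1"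
      unfolding K_def using q by linarith+
    have Lrm: "L * r ^ Suc m = \<delta> / (2 * q) / \<beta> ^ n"
    proof -
      have "L * r ^ Suc m = l / q" by (simp add: l_def r_def)
      also note l_eq
      finally show ?thesis by simp
    qed
    have c_diff: "c i - c j = (real i - real j) * (2 * (L * r ^ Suc m))" for i j
      unfolding Lrm c_def p_def by (simp add: algebra_simps add_divide_distrib diff_divide_distrib)
    have dq: "0 < \<delta> / q" using \<delta> q by simp
    \<comment> \<open>Strictness at \<open>v\<close> matters: nodes are closed intervals, but
      affinity is known only on \<open>[u, v)\<close>.\<close>
    have p_bounds: "u + \<epsilon> \<le> p i" "p i + \<delta> / (2 * q) < v" if "i < K" for i
    proof -
      show "u + \<epsilon> \<le> p i" using \<delta> q by (simp add: p_def)
      have "(real i + 1) * (\<delta> / q) \<le> (q * 24 / 100) * (\<delta> / q)"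
        using that K dq by (intro mult_right_mono) linarith+
      also have "\<dots> = \<delta> * 24 / 100" using q by simp
      finally have "p i + \<delta> / q \<le> v" using uv by (simp add: p_def \<epsilon>_def algebra_simps)
      moreover have "\<delta> / (2 * q) < \<delta> / q" using dq by (simp add: field_simps)
      ultimately show "p i + \<delta> / (2 * q) < v" by simp
    qed
    have c_sub: "{c i..c i + L * r ^ Suc m} \<subseteq> {a..a + l}" if "i < K" for i
    proof -
      have "0 \<le> (p i - y) / \<beta> ^ n" using p_bounds[OF that] uv \<epsilon> bn by simp
      moreover have "(p i - y) / \<beta> ^ n + \<delta> / (2 * q) / \<beta> ^ n \<le> \<delta> / 2 / \<beta> ^ n"
        unfolding add_divide_distrib[symmetric]
        using p_bounds(2)[OF that] uv(2) bn by (intro divide_right_mono) linarith+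
      ultimately show ?thesis unfolding l_eq Lrm by (auto simp: c_def)
    qed
    have G_c: "G (Suc m) (c i)" if i: "i < K" for i
      unfolding G_def
    proof (intro conjI allI impI ballI)
      have ci: "c i \<in> {c i..c i + L * r ^ Suc m}" using L r by simp
      then have ca: "c i \<in> {a..a + l}" using c_sub[OF i] by blast
      then show "0 \<le> c i" using a by simp
      have "c i + L * r ^ Suc m \<in> {c i..c i + L * r ^ Suc m}" using L r by simp
      then show "c i + L * r ^ Suc m < \<epsilon>" using c_sub[OF i] a by fastforce
      fix j x assume j: "j \<le> N * Suc (Suc m)" and x: "x \<in> {c i..c i + L * r ^ Suc m}"
      have xa: "x \<in> {a..a + l}" using c_sub[OF i] x by blast
      have "(f ^^ j) x = (f ^^ j) (c i) + \<beta> ^ j * (x - c i) \<and> x \<le> (f ^^ j) x"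
      \<comment> \<open>Up to time \<open>n\<close> everything is inherited from the parent;
        afterwards the image moves inside the affine piece \<open>[u, v)\<close>.\<close>
      proof (cases "j \<le> n")
        case True
        with aff(1)[OF True xa] aff(1)[OF True ca] aff(2)[OF True xa] show ?thesis
          by (simp add: algebra_simps)
      next
        case False
        then obtain k where k: "j = k + n" "k \<le> N"
          using j that by (intro that[of "j - n"]) (auto simp: n_def)
        have "\<beta> ^ n * (c i - a) = p i - y" using params by (simp add: c_def)
        then have img: "(f ^^ n) z = p i + \<beta> ^ n * (z - c i)" if "z \<in> {a..a + l}" for z
          using aff(1)[OF order_refl that] by (simp add: y_def algebra_simps)
        have "\<beta> ^ n * (x - c i) \<le> \<beta> ^ n * (L * r ^ Suc m)"
          using x bn by (intro mult_left_mono) auto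
        also have "\<dots> = \<delta> / (2 * q)" unfolding Lrm using params by simp
        finally have le: "\<beta> ^ n * (x - c i) \<le> \<delta> / (2 * q)" .
        have ge: "0 \<le> \<beta> ^ n * (x - c i)" using x bn by simp
        have uv': "p i \<in> {u..<v}" "p i + \<beta> ^ n * (x - c i) \<in> {u..<v}"
          using p_bounds[OF i] \<epsilon> le ge by auto
        have fz: "(f ^^ k) z = (f ^^ k) u + \<beta> ^ k * (z - u)" if "z \<in> {u..<v}" for z
          by (rule affine_onD[OF uv(4) k(2) that])
        have jx: "(f ^^ j) x = (f ^^ k) u + \<beta> ^ k * (p i + \<beta> ^ n * (x - c i) - u)"
          using fz[OF uv'(2)] img[OF xa] by (simp add: k funpow_add)
        have jc: "(f ^^ j) (c i) = (f ^^ k) u + \<beta> ^ k * (p i - u)"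
          using fz[OF uv'(1)] img[OF ca] by (simp add: k funpow_add)
        \<comment> \<open>The image at time \<open>n\<close> is at least \<open>\<epsilon>\<close>
          to the right of \<open>u\<close>, and expansion does not shrink this distance, while
          \<open>(f ^^ k) u\<close> is nonnegative.\<close>
        have "\<epsilon> \<le> 1 * (p i + \<beta> ^ n * (x - c i) - u)"
          using p_bounds[OF i] ge by simp
        also have "\<dots> \<le> \<beta> ^ k * (p i + \<beta> ^ n * (x - c i) - u)"
          using params uv'(2) by (intro mult_right_mono) auto
        also have "\<dots> \<le> (f ^^ j) x"
          unfolding jx using nonneg[of u k] uv y0 uv' y1 by auto
        finally have "\<epsilon> \<le> (f ^^ j) x" by simp
        then show ?thesis
          using jx jc xa a by (simp add: k power_add algebra_simps)
      qed
      then show "(f ^^ j) x = (f ^^ j) (c i) + \<beta> ^ j * (x - c i)" "x \<le> (f ^^ j) x" by auto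
    qed
    have gap: "2 * (L * r ^ Suc m) \<le> \<bar>c i - c j\<bar>" if "i \<noteq> j" for i j
    proof -
      have "1 * (2 * (L * r ^ Suc m)) \<le> \<bar>real i - real j\<bar> * (2 * (L * r ^ Suc m))"
        using that L r by (intro mult_right_mono) (auto simp: abs_if)
      then show ?thesis using L r by (simp add: c_diff abs_mult)
    qed
    have "inj_on c {..<K}"
    proof (rule inj_onI, rule ccontr)
      fix i j assume "c i = c j" "i \<noteq> j"
      moreover have "0 < L * r ^ Suc m" using L r by simp
      ultimately show False using gap[of i j] by simp
    qed
    then have card: "card (c ` {..<K}) = K" by (simp add: card_image)
    show "\<exists>C. finite C \<and> (1 / r) powr s \<le> real (card C) \<and>
        (\<forall>c\<in>C. G (Suc m) c \<and> {c..c + L * r ^ Suc m} \<subseteq> {a..a + L * r ^ m}) \<and>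
        pairwise (\<lambda>c d. 2 * (L * r ^ Suc m) \<le> \<bar>c - d\<bar>) C"
    proof (intro exI[of _ "c ` {..<K}"] conjI ballI)
      \<comment> \<open>By rounding \<open>K\<close> exceeds \<open>q * 24 / 100 - 1\<close>, which
        is at least \<open>q / 5\<close> and hence at least \<open>q powr s\<close>.\<close>
      show "(1 / r) powr s \<le> real (card (c ` {..<K}))"
        using qs K q by (simp add: card r_def)
      show "pairwise (\<lambda>c d. 2 * (L * r ^ Suc m) \<le> \<bar>c - d\<bar>) (c ` {..<K})"
        by (rule pairwise_imageI) (rule gap)
      fix d assume "d \<in> c ` {..<K}"
      then obtain i where "i < K" "d = c i" by auto
      then show "G (Suc m) d" "{d..d + L * r ^ Suc m} \<subseteq> {a..a + L * r ^ m}"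
        using G_c c_sub[of i] unfolding l_def by blast+
    qed simp
  next
    fix x assume x: "\<And>m. \<exists>a. G m a \<and> x \<in> {a..a + L * r ^ m}"
    have "x \<le> (f ^^ j) x" for j
    proof -
      from x[of j] obtain a where a: "G j a" "x \<in> {a..a + L * r ^ j}" by blast
      \<comment> \<open>With \<open>N\<close> positive, a node of level \<open>j\<close> controls at
        least the first \<open>j\<close> iterates.\<close>
      have "N \<noteq> 0" using q(1) by (intro notI) (simp add: q_def)
      then have "j \<le> N * Suc j" by (cases N) auto
      with a show ?thesis unfolding G_def by blast
    qed
    moreover have "x \<in> {0..<1}"
    proof -
      from x[of 0] obtain a where a: "G 0 a" "x \<in> {a..a + L * r ^ 0}" by blast
      then have "0 \<le> a" "a + L * r ^ 0 < \<epsilon>" unfolding G_def by blast+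
      with a(2) \<epsilon> show ?thesis by simp
    qed
    ultimately show "x \<in> E_plus \<beta> \<alpha>" by (auto simp: E_plus_def not_less)
  qed
qed

text \<open>The tree argument requires \<open>0 < s\<close>. At exponent 0 every nonempty covering
  set weighs 1, and 0 lies in the set because \<open>[0, 0)\<close> is empty.\<close>

lemma hausdorff_measure_0_E_plus_ne_0: "hausdorff_measure 0 (E_plus \<beta> \<alpha>) \<noteq> 0"
proof
  assume null: "hausdorff_measure 0 (E_plus \<beta> \<alpha>) = 0"
  have "hausdorff_pre_measure 0 1 (E_plus \<beta> \<alpha>) \<le> hausdorff_measure 0 (E_plus \<beta> \<alpha>)"
    unfolding hausdorff_measure_def by (rule SUP_upper) simp
  then have "hausdorff_pre_measure 0 1 (E_plus \<beta> \<alpha>) < 1" using null by simp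
  then obtain U :: "nat \<Rightarrow> real set" where U: "E_plus \<beta> \<alpha> \<subseteq> (\<Union>i. U i)"
    "(\<Sum>i. hausdorff_gauge 0 (U i)) < 1"
    unfolding hausdorff_pre_measure_def Inf_less_iff by blast
  have "0 \<in> E_plus \<beta> \<alpha>" by (simp add: E_plus_def)
  with U(1) obtain i where "0 \<in> U i" by blast
  then have "1 = sum (\<lambda>i. hausdorff_gauge 0 (U i)) {i}" by (auto simp: hausdorff_gauge_def)
  also have "\<dots> \<le> (\<Sum>i. hausdorff_gauge 0 (U i))" by (intro sum_le_suminf) auto
  finally show False using U(2) by simp
qed

end

theorem corollary1p5:
  fixes \<beta> \<alpha> :: real
  assumes "(\<beta>, \<alpha>) \<in> Delta"
  shows "hausdorff_dim (E_plus \<beta> \<alpha>) = 1"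
proof (rule antisym)
  interpret beta_map \<beta> \<alpha> by standard (rule assms)
  show "hausdorff_dim (E_plus \<beta> \<alpha>) \<le> 1"
  \<comment> \<open>The measure is known to vanish only for exponents above 1, so the bound is
    reached through \<open>1 + e\<close>.\<close>
  proof (rule ennreal_le_epsilon)
    fix e :: real assume "e > 0"
    then have "hausdorff_measure (1 + e) (E_plus \<beta> \<alpha>) = 0"
      by (intro hausdorff_measure_eq_0_of_gt_1) (auto simp: E_plus_def)
    then have "hausdorff_dim (E_plus \<beta> \<alpha>) \<le> ennreal (1 + e)"
      unfolding hausdorff_dim_def using \<open>e > 0\<close> by (intro Inf_lower CollectI exI[of _ "1 + e"]) auto
    then show "hausdorff_dim (E_plus \<beta> \<alpha>) \<le> 1 + ennreal e"
      using \<open>e > 0\<close> by (simp add: ennreal_plus)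
  qed
  show "1 \<le> hausdorff_dim (E_plus \<beta> \<alpha>)"
    unfolding hausdorff_dim_def
  proof (rule Inf_greatest)
    fix z assume "z \<in> {ennreal s | s. s \<ge> 0 \<and> hausdorff_measure s (E_plus \<beta> \<alpha>) = 0}"
    then obtain s where s: "z = ennreal s" "s \<ge> 0" "hausdorff_measure s (E_plus \<beta> \<alpha>) = 0" by blast
    have "s \<noteq> 0" using s(3) hausdorff_measure_0_E_plus_ne_0 by metis
    then have "s \<ge> 1" using s(2,3) hausdorff_measure_E_plus_ne_0[of s] by linarith
    then show "1 \<le> z" using s by (simp add: ennreal_ge_1)
  qed
qed

end
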